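(* For sufficiently large $n$, there is a convex body $K$ in $\mathbb{R}^n$ and a family $\mathcal{F}$ of translates of $K$ such that $$\tau(\mathcal{F})\ge\tfrac12\,(1.058)^n\,\nu(\mathcal{F}).$$
   Context: A convex body in $\mathbb{R}^n$ is a compact convex set with non-empty interior. A translate of $K$ is a set $K+x$ with $x\in\mathbb{R}^n$. For a family of sets $\mathcal{F}$, the transversal number is $\tau(\mathcal{F})=\min\{\operatorname{card}(S) : S\cap F\neq\emptyset \text{ for all } F\in\mathcal{F}\}$ (where $S$ ranges over sets of points of $\mathbb{R}^n$), and the independence number is $\nu(\mathcal{F})=\max\{\operatorname{card}(S) : S\subseteq\mathcal{F} \text{ and } S \text{ is pairwise disjoint}\}$. Here $\operatorname{card}(S)$ denotes the cardinality of $S$. *)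

theory Defs
  imports "HOL-Analysis.Analysis" "HOL-Library.Disjoint_Sets"
begin

text \<open>
  The dimension is quantified inside the statement, so it cannot be a type: a point of \<open>n\<close>-space is
  a sequence \<open>x :: nat \<Rightarrow> real\<close> with \<open>x i = 0\<close> for \<open>i \<ge> n\<close>, that is, an element of
  \<^term>\<open>topspace (Euclidean_space n)\<close>. The type \<^typ>\<open>nat \<Rightarrow> real\<close> is no instance of
  \<^class>\<open>real_vector\<close>, so the linear structure is written out coordinatewise.
\<close>

definition convex_body :: "nat \<Rightarrow> (nat \<Rightarrow> real) set \<Rightarrow> bool" where
  "convex_body n K \<longleftrightarrow>
     compactin (Euclidean_space n) K \<and>
     (\<forall>x\<in>K. \<forall>y\<in>K. \<forall>t\<in>{0..1}. (\<lambda>i. (1 - t) * x i + t * y i) \<in> K) \<and>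
     Euclidean_space n interior_of K \<noteq> {}"

definition translates :: "nat \<Rightarrow> (nat \<Rightarrow> real) set \<Rightarrow> (nat \<Rightarrow> real) set set" where
  "translates n K =
     {(\<lambda>y i. y i + x i) ` K | x. x \<in> topspace (Euclidean_space n)}"

text \<open>\<^const>\<open>card\<close> is 0 on infinite sets, hence an \<^typ>\<open>enat\<close>-valued cardinality.\<close>

definition ecard :: "'a set \<Rightarrow> enat" where
  "ecard S = (if finite S then enat (card S) else \<infinity>)"

text \<open>
  On \<^typ>\<open>enat\<close>, \<open>Inf\<close> of a nonempty set is its least element, and a finite \<open>Sup\<close> of a nonempty set
  is its greatest element.
\<close>

definition transversal_number :: "nat \<Rightarrow> (nat \<Rightarrow> real) set set \<Rightarrow> enat" where
  "transversal_number n \<F> =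
     Inf {ecard S | S. S \<subseteq> topspace (Euclidean_space n) \<and> (\<forall>F\<in>\<F>. S \<inter> F \<noteq> {})}"

definition independence_number :: "'a set set \<Rightarrow> enat" where
  "independence_number \<F> = Sup {ecard S | S. S \<subseteq> \<F> \<and> disjoint S}"

end

theory Submission
  imports Defs
begin

text \<open>
  The family consists of the translates \<open>K + x\<close>, where \<open>x\<close> runs over an exponentially large finite set
  \<open>X\<close> and the body \<open>K\<close> is adapted to \<open>X\<close>. Suppose that \<open>K\<close> is symmetric about the origin and that all
  the half differences \<open>(a - b) / 2\<close> of distinct points of \<open>X\<close> are extreme points of \<open>K\<close>. Then:

  \<^item> \<open>K + x\<close> and \<open>K + y\<close> both contain the midpoint of \<open>x\<close> and \<open>y\<close>, so the family is pairwise
    intersecting and its independence number is 1.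
  \<^item> If \<open>t\<close> lies in \<open>K + a\<close> and in \<open>K + b\<close>, then \<open>a - t\<close> and \<open>t - b\<close> are points of \<open>K\<close> with sum \<open>a - b\<close>,
    that is, with the extreme point \<open>(a - b) / 2\<close> as midpoint. Hence both are equal to it and \<open>t\<close> is
    the midpoint of \<open>a\<close> and \<open>b\<close>. No point is the midpoint of two pairs that share one element, so
    \<open>t\<close> lies in at most two members, and a transversal needs at least \<open>card X / 2\<close> points
    (\<open>acute_set_family\<close>).

  The half differences can be made extreme if each pair of points of \<open>X\<close> is strictly separated from
  the rest of \<open>X\<close> by two parallel hyperplanes through the two points. This holds when \<open>X\<close> is acute,
  meaning that three distinct points always form an acute triangle: the hyperplanes orthogonal to
  \<open>a - b\<close> work (\<open>acute_set_strictly_antipodal\<close>). The inequalities are strict and finite in number, so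
  they survive a small tilt of the hyperplanes along each coordinate axis. The body \<open>K\<close> is the
  polytope cut out by all these tilted functionals (\<open>acute_set_body\<close>); enough of its defining
  inequalities are equalities at \<open>(a - b) / 2\<close> to make it a vertex.

  Acute sets of size \<open>2 ^ (n div 2)\<close> exist, because two further dimensions allow each point to be
  replaced by two nearby points (\<open>acute_set_double\<close>), and this number exceeds \<open>1.058 ^ n\<close> from
  \<open>n = 2\<close> on.
\<close>

section \<open>Small perturbations of finitely many strict inequalities\<close>

lemma ex_pos_perturbation:
  fixes f g :: "'a \<Rightarrow> real"
  assumes "finite A" and "\<And>x. x \<in> A \<Longrightarrow> 0 < f x"
  shows "\<exists>s>0. \<forall>x\<in>A. 0 < f x + s * g x"
proof -
  have "\<forall>\<^sub>F s in at_right 0. 0 < f x + s * g x" if "x \<in> A" for x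
  proof -
    have "((\<lambda>s. f x + s * g x) \<longlongrightarrow> f x + 0 * g x) (at_right 0)"
      by (intro tendsto_intros)
    then show ?thesis
      using assms(2)[OF that] by (intro order_tendstoD(1)[where y = "f x"]) auto
  qed
  then have "\<forall>\<^sub>F s in at_right 0. \<forall>x\<in>A. 0 < f x + s * g x"
    using assms(1) by (simp add: eventually_ball_finite)
  then have "\<forall>\<^sub>F s in at_right 0. 0 < s \<and> (\<forall>x\<in>A. 0 < f x + s * g x)"
    using eventually_at_right_less[of "0::real"] by eventually_elim auto
  then show ?thesis
    using eventually_happens'[OF trivial_limit_at_right_real] by blast
qed

section \<open>Acute sets\<close>

definition dot :: "nat \<Rightarrow> (nat \<Rightarrow> real) \<Rightarrow> (nat \<Rightarrow> real) \<Rightarrow> real" where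
  "dot n x y = (\<Sum>i<n. x i * y i)"

lemma dot_diff_left: "dot n (\<lambda>i. x i - y i) z = dot n x z - dot n y z"
  and dot_diff_right: "dot n z (\<lambda>i. x i - y i) = dot n z x - dot n z y"
  by (simp_all add: dot_def algebra_simps sum_subtractf)

text \<open>In the case \<open>b = c\<close> the condition says that \<open>b - a\<close> has positive length, which is automatic for
  distinct points of \<open>Euclidean_space n\<close>; all other cases are the acute angles at \<open>a\<close>.\<close>
definition acute_set :: "nat \<Rightarrow> (nat \<Rightarrow> real) set \<Rightarrow> bool" where
  "acute_set n X \<longleftrightarrow> X \<subseteq> topspace (Euclidean_space n) \<and>
     (\<forall>a\<in>X. \<forall>b\<in>X. \<forall>c\<in>X. b \<noteq> a \<longrightarrow> c \<noteq> a \<longrightarrow>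
        0 < dot n (\<lambda>i. b i - a i) (\<lambda>i. c i - a i))"

lemma acute_setD:
  assumes "acute_set n X" "a \<in> X" "b \<in> X" "c \<in> X" "b \<noteq> a" "c \<noteq> a"
  shows "0 < dot n (\<lambda>i. b i - a i) (\<lambda>i. c i - a i)"
  using assms by (auto simp: acute_set_def)

text \<open>Any angles that are distinct elements of the interval from 0 to 1 give such vectors: two of them
  enclose an angle strictly between 0 and a right angle. These vectors are the directions in which the
  points of an acute set are split.\<close>
lemma ex_unit_vectors_in_general_directions:
  fixes X :: "'a set"
  assumes "finite X"
  obtains u v :: "'a \<Rightarrow> real"
  where "\<And>x. u x * u x + v x * v x = 1"
    and "\<And>x y. x \<in> X \<Longrightarrow> y \<in> X \<Longrightarrow> x \<noteq> y \<Longrightarrow> \<bar>u x * u y + v x * v y\<bar> < 1"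
proof -
  obtain h :: "'a \<Rightarrow> nat" where h: "inj_on h X"
    using finite_imp_inj_to_nat_seg[OF assms] by blast
  define \<theta> where "\<theta> x = 1 / real (Suc (h x))" for x
  have \<theta>: "0 < \<theta> x" "\<theta> x \<le> 1" for x
    by (auto simp: \<theta>_def divide_simps)
  have "\<bar>cos (\<theta> x - \<theta> y)\<bar> < 1" if "x \<in> X" "y \<in> X" "x \<noteq> y" for x y
  proof -
    have "\<theta> x \<noteq> \<theta> y"
      using inj_onD[OF h] that by (auto simp: \<theta>_def)
    then have *: "0 < \<bar>\<theta> x - \<theta> y\<bar>" "\<bar>\<theta> x - \<theta> y\<bar> < 1"
      using \<theta>[of x] \<theta>[of y] by auto
    then have "cos \<bar>\<theta> x - \<theta> y\<bar> < cos 0" "0 < cos \<bar>\<theta> x - \<theta> y\<bar>"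
      using pi_gt3 by (intro cos_monotone_0_pi cos_gt_zero; simp)+
    then show ?thesis by simp
  qed
  moreover have "cos t * cos t + sin t * sin t = 1" for t :: real
    by (metis power2_eq_square sin_cos_squared_add2)
  ultimately show ?thesis
    by (intro that[of "\<lambda>x. cos (\<theta> x)" "\<lambda>x. sin (\<theta> x)"]) (auto simp: cos_diff)
qed

text \<open>Each \<open>x\<close> splits into two points that differ from it by opposite vectors of a small common length
  in the two new coordinates, in a direction that depends on \<open>x\<close>. An angle at a copy of \<open>a\<close> between
  copies of other points is a small perturbation of an angle at \<open>a\<close> in \<open>X\<close>, or of the angle 0 if they
  are copies of the same point. If another vertex is the other copy of \<open>a\<close>, the first \<open>n\<close> coordinates contribute nothing and the
  positive contribution comes from the new ones, however small the length is.\<close>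
lemma acute_set_double:
  assumes X: "acute_set n X" "finite X"
  shows "\<exists>Y. acute_set (n + 2) Y \<and> finite Y \<and> card Y = 2 * card X"
proof -
  obtain u v :: "(nat \<Rightarrow> real) \<Rightarrow> real"
    where unit: "\<And>x. u x * u x + v x * v x = 1"
      and uv: "\<And>x y. x \<in> X \<Longrightarrow> y \<in> X \<Longrightarrow> x \<noteq> y \<Longrightarrow> \<bar>u x * u y + v x * v y\<bar> < 1"
    by (rule ex_unit_vectors_in_general_directions[OF X(2)]) blast
  \<comment> \<open>the contribution of the two new coordinates, for offset vectors of length 1\<close>
  define Q where "Q a \<sigma> b \<tau> c \<rho> =
      (\<tau> * u b - \<sigma> * u a) * (\<rho> * u c - \<sigma> * u a) + (\<tau> * v b - \<sigma> * v a) * (\<rho> * v c - \<sigma> * v a)"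
    for a b c and \<sigma> \<tau> \<rho> :: real
  define P where "P = X \<times> {1, -1 :: real}"
  have finP: "finite P" using X by (simp add: P_def)
  define T where "T = {(p, q, r) \<in> P \<times> P \<times> P. fst q \<noteq> fst p \<and> fst r \<noteq> fst p}"
  have "finite T"
    unfolding T_def by (rule finite_subset[of _ "P \<times> P \<times> P"]) (use finP in auto)
  then have "\<exists>s>0. \<forall>t\<in>T. 0 <
      (case t of ((a, \<sigma>), (b, \<tau>), (c, \<rho>)) \<Rightarrow> dot n (\<lambda>i. b i - a i) (\<lambda>i. c i - a i))
      + s * (case t of ((a, \<sigma>), (b, \<tau>), (c, \<rho>)) \<Rightarrow> Q a \<sigma> b \<tau> c \<rho>)"
    by (rule ex_pos_perturbation) (auto simp: T_def P_def intro!: acute_setD[OF X(1)])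
  then obtain s where s: "0 < s"
    and sT: "\<And>a b c \<sigma> \<tau> \<rho>. ((a, \<sigma>), (b, \<tau>), (c, \<rho>)) \<in> T \<Longrightarrow>
      0 < dot n (\<lambda>i. b i - a i) (\<lambda>i. c i - a i) + s * Q a \<sigma> b \<tau> c \<rho>"
    by fastforce
  \<comment> \<open>Offsets of length \<open>sqrt s\<close> scale the contribution \<open>Q\<close> by \<open>s\<close>.\<close>
  define g where "g = (\<lambda>(x, \<sigma>) i. if i < n then x i else if i = n then sqrt s * \<sigma> * u x
      else if i = Suc n then sqrt s * \<sigma> * v x else (0::real))"
  have dot_g: "dot (n + 2) (\<lambda>i. g (b, \<tau>) i - g (a, \<sigma>) i) (\<lambda>i. g (c, \<rho>) i - g (a, \<sigma>) i)
      = dot n (\<lambda>i. b i - a i) (\<lambda>i. c i - a i) + s * Q a \<sigma> b \<tau> c \<rho>" for a b c \<sigma> \<tau> \<rho>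
  proof -
    have "sqrt s * sqrt s = s" using s by simp
    then have [simp]: "sqrt s * (sqrt s * z) = s * z" for z
      by (metis mult.assoc)
    show ?thesis
      by (simp add: dot_def g_def Q_def algebra_simps)
  qed
  \<comment> \<open>Of all the offset vectors, which have equal length, \<open>\<sigma> (u a, v a)\<close> is the unique one with the
    largest component along itself.\<close>
  have twin: "0 < Q a \<sigma> a (-\<sigma>) c \<rho>"
    if "(a, \<sigma>) \<in> P" "(c, \<rho>) \<in> P" "(c, \<rho>) \<noteq> (a, \<sigma>)" for a c \<sigma> \<rho>
  proof -
    have \<sigma>: "\<sigma> * \<sigma> = 1" using that by (auto simp: P_def)
    have "Q a \<sigma> a (-\<sigma>) c \<rho> = 2 * (\<sigma> * \<sigma>) * (u a * u a + v a * v a)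
        - 2 * (\<sigma> * \<rho>) * (u a * u c + v a * v c)"
      by (simp add: Q_def algebra_simps)
    then have Q: "Q a \<sigma> a (-\<sigma>) c \<rho> = 2 - 2 * (\<sigma> * \<rho>) * (u a * u c + v a * v c)"
      by (simp add: \<sigma> unit)
    show ?thesis
    proof (cases "c = a")
      case True
      then show ?thesis using that unfolding Q by (auto simp: P_def unit)
    next
      case False
      then have "\<bar>u a * u c + v a * v c\<bar> < 1" using that by (intro uv) (auto simp: P_def)
      then show ?thesis using that unfolding Q by (auto simp: P_def)
    qed
  qed
  have Q_comm: "Q a \<sigma> b \<tau> c \<rho> = Q a \<sigma> c \<rho> b \<tau>" for a b c \<sigma> \<tau> \<rho>
    by (simp add: Q_def mult.commute)
  have sgn: "\<tau> = -\<sigma>" if "(a, \<sigma>) \<in> P" "(a, \<tau>) \<in> P" "\<tau> \<noteq> \<sigma>" for a and \<sigma> \<tau> :: real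
    using that by (auto simp: P_def)
  have acute: "0 < dot (n + 2) (\<lambda>i. g q i - g p i) (\<lambda>i. g r i - g p i)"
    if "p \<in> P" "q \<in> P" "r \<in> P" "q \<noteq> p" "r \<noteq> p" for p q r
  proof -
    obtain a \<sigma> b \<tau> c \<rho> where [simp]: "p = (a, \<sigma>)" "q = (b, \<tau>)" "r = (c, \<rho>)"
      by (metis surj_pair)
    have "0 < dot n (\<lambda>i. b i - a i) (\<lambda>i. c i - a i) + s * Q a \<sigma> b \<tau> c \<rho>"
    proof (cases "b = a \<or> c = a")
      case True
      then have "dot n (\<lambda>i. b i - a i) (\<lambda>i. c i - a i) = 0"
        by (auto simp: dot_def)
      moreover have "0 < Q a \<sigma> b \<tau> c \<rho>"
        using True
      proof
        assume "b = a"
        with that have "\<tau> = -\<sigma>" by (intro sgn[of a]) auto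
        with \<open>b = a\<close> show ?thesis using that twin[of a \<sigma> c \<rho>] by simp
      next
        assume "c = a"
        with that have "\<rho> = -\<sigma>" by (intro sgn[of a]) auto
        with \<open>c = a\<close> show ?thesis using that twin[of a \<sigma> b \<tau>] by (simp add: Q_comm)
      qed
      ultimately show ?thesis using s by simp
    next
      case False
      then show ?thesis using that by (intro sT) (auto simp: T_def)
    qed
    then show ?thesis by (simp only: dot_g \<open>p = _\<close> \<open>q = _\<close> \<open>r = _\<close>)
  qed
  \<comment> \<open>If \<open>p\<close> and \<open>q\<close> had the same image, the angle at \<open>p\<close> between \<open>q\<close> and \<open>q\<close> would have dot product 0.\<close>
  have inj: "inj_on g P"
  proof (rule inj_onI, rule ccontr)
    fix p q assume "p \<in> P" "q \<in> P" "g p = g q" "p \<noteq> q"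
    with acute[of p q q] show False by (simp add: dot_def)
  qed
  have "g ` P \<subseteq> topspace (Euclidean_space (n + 2))"
    by (auto simp: topspace_Euclidean_space g_def)
  then have "acute_set (n + 2) (g ` P)"
    unfolding acute_set_def using acute by blast
  moreover have "card (g ` P) = 2 * card X"
    using card_image[OF inj] by (simp add: P_def card_cartesian_product)
  ultimately show ?thesis using finP by blast
qed

lemma ex_acute_set: "\<exists>X. acute_set n X \<and> finite X \<and> card X = 2 ^ (n div 2)"
proof (induction n rule: nat_less_induct)
  case (1 n)
  show ?case
  proof (cases "n < 2")
    case True
    then show ?thesis
      by (intro exI[of _ "{\<lambda>_. 0}"]) (auto simp: acute_set_def topspace_Euclidean_space)
  next
    case False
    then have n: "n - 2 < n" "n - 2 + 2 = n" by auto
    with 1 obtain X where "acute_set (n - 2) X" "finite X" "card X = 2 ^ ((n - 2) div 2)"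
      by blast
    moreover have "2 * 2 ^ ((n - 2) div 2) = (2::nat) ^ (n div 2)"
      using False by (metis div2_Suc_Suc le_add_diff_inverse2 n(2) add_2_eq_Suc' power_Suc)
    ultimately show ?thesis
      using acute_set_double[of "n - 2" X] n by metis
  qed
qed

section \<open>Polytopes as convex bodies\<close>

lemma continuous_on_dot: "continuous_on UNIV (dot n w)"
  unfolding dot_def by (intro continuous_intros) (rule continuous_on_product_coordinates)

text \<open>As the right-hand sides are positive, the inequalities hold strictly at the origin, hence in a
  neighbourhood of it; this gives the interior point.\<close>
lemma convex_body_polytope:
  fixes w :: "'i \<Rightarrow> nat \<Rightarrow> real" and h :: "'i \<Rightarrow> real"
  assumes fin: "finite I" and h: "\<And>i. i \<in> I \<Longrightarrow> 0 < h i"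
    and K: "K = {p \<in> topspace (Euclidean_space n). \<forall>i\<in>I. dot n (w i) p \<le> h i}"
    and bdd: "\<And>p k. p \<in> K \<Longrightarrow> k < n \<Longrightarrow> \<bar>p k\<bar> \<le> R"
  shows "convex_body n K"
  unfolding convex_body_def
proof (intro conjI ballI)
  define B where "B = (\<Pi>\<^sub>E k\<in>UNIV. if k < n then {-R..R} else {0::real})"
  have "compactin (powertop_real UNIV) B"
    unfolding B_def by (subst compactin_PiE) auto
  moreover have "B \<subseteq> {x. \<forall>i\<ge>n. x i = 0}"
    by (auto simp: B_def PiE_iff split: if_splits)
  ultimately have "compactin (Euclidean_space n) B"
    by (simp add: Euclidean_space_def compactin_subtopology)
  moreover have "K \<subseteq> B"
  proof
    fix p assume "p \<in> K"
    then show "p \<in> B"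
      using bdd[of p] by (auto simp: B_def K topspace_Euclidean_space abs_le_iff minus_le_iff)
  qed
  moreover have "closedin (Euclidean_space n) K"
  proof -
    have "closed (\<Inter>i\<in>I. {p. dot n (w i) p \<le> h i})"
      by (intro closed_INT ballI closed_Collect_le continuous_on_dot continuous_on_const)
    moreover have "closed (topspace (Euclidean_space n))"
      using closedin_Euclidean_space[of n] by (simp add: euclidean_product_topology)
    moreover have "K = topspace (Euclidean_space n) \<inter> (\<Inter>i\<in>I. {p. dot n (w i) p \<le> h i})"
      by (auto simp: K)
    ultimately show ?thesis
      by (auto simp: closedin_Euclidean_space_iff)
  qed
  ultimately show "compactin (Euclidean_space n) K"
    using closed_compactin by blast
next
  fix x y and t :: real
  assume xy: "x \<in> K" "y \<in> K" and t: "t \<in> {0..1}"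
  have "dot n (w i) (\<lambda>j. (1 - t) * x j + t * y j) \<le> h i" if "i \<in> I" for i
  proof -
    have "dot n (w i) (\<lambda>j. (1 - t) * x j + t * y j)
        = (1 - t) * dot n (w i) x + t * dot n (w i) y"
      by (simp add: dot_def sum_distrib_left algebra_simps flip: sum.distrib sum_subtractf)
    also have "\<dots> \<le> h i"
      using xy t that by (intro convex_bound_le) (auto simp: K)
    finally show ?thesis .
  qed
  then show "(\<lambda>j. (1 - t) * x j + t * y j) \<in> K"
    using xy by (auto simp: K topspace_Euclidean_space)
next
  define U where "U = topspace (Euclidean_space n) \<inter> (\<Inter>i\<in>I. {p. dot n (w i) p < h i})"
  have "open (\<Inter>i\<in>I. {p. dot n (w i) p < h i})"
    using fin by (intro open_INT ballI open_Collect_less continuous_on_dot continuous_on_const)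
  then have "openin (Euclidean_space n) U"
    by (auto simp: U_def Euclidean_space_def euclidean_product_topology openin_subtopology
        Int_commute)
  moreover have "U \<subseteq> K" by (auto simp: U_def K intro: less_imp_le)
  moreover have "(\<lambda>_. 0) \<in> U"
    using h by (auto simp: U_def topspace_Euclidean_space dot_def)
  ultimately show "Euclidean_space n interior_of K \<noteq> {}"
    using interior_of_maximal by blast
qed

section \<open>A body on which an acute set is equilateral\<close>

definition tilted_diff :: "(nat \<Rightarrow> real) \<Rightarrow> (nat \<Rightarrow> real) \<Rightarrow> nat \<Rightarrow> real \<Rightarrow> nat \<Rightarrow> real" where
  "tilted_diff a b k r = (\<lambda>i. a i - b i + (if i = k then r else 0))"

lemma dot_tilted_diff:
  assumes "k < n"
  shows "dot n (tilted_diff a b k r) y = dot n (\<lambda>i. a i - b i) y + r * y k"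
proof -
  have "dot n (tilted_diff a b k r) y
      = dot n (\<lambda>i. a i - b i) y + (\<Sum>i<n. if i = k then r * y i else 0)"
    unfolding dot_def tilted_diff_def sum.distrib[symmetric]
    by (intro sum.cong) (auto simp: algebra_simps)
  then show ?thesis using assms by simp
qed

text \<open>An acute angle at \<open>a\<close> puts every other point of \<open>X\<close> strictly below \<open>a\<close> in the direction \<open>a - b\<close>,
  and an acute angle at \<open>b\<close> puts it strictly above \<open>b\<close>. So the width of \<open>X\<close> in this direction is
  attained by the pair \<open>(a, b)\<close> alone.\<close>
lemma acute_set_strictly_antipodal:
  assumes X: "acute_set n X" and ab: "a \<in> X" "b \<in> X" "a \<noteq> b"
    and xy: "x \<in> X" "y \<in> X" "(x, y) \<noteq> (a, b)"
  shows "dot n (\<lambda>i. a i - b i) (\<lambda>i. x i - y i) < dot n (\<lambda>i. a i - b i) (\<lambda>i. a i - b i)"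
proof -
  let ?d = "dot n (\<lambda>i. a i - b i)"
  have neg: "dot n (\<lambda>i. b i - a i) z = - ?d z" for z
    by (simp add: dot_diff_left)
  have "?d x < ?d a" if "x \<noteq> a"
    using acute_setD[OF X ab(1,2) xy(1)] that ab(3) by (simp add: neg dot_diff_right)
  moreover have "?d b < ?d y" if "y \<noteq> b"
    using acute_setD[OF X ab(2,1) xy(2)] that ab(3) by (simp add: dot_diff_right)
  ultimately show ?thesis
    using xy(3) by (cases "x = a"; cases "y = b") (auto simp: dot_diff_right)
qed

lemma acute_set_robustly_antipodal:
  assumes X: "acute_set n X" "finite X"
  obtains s where "0 < s"
    and "\<And>a b x y k r. a \<in> X \<Longrightarrow> b \<in> X \<Longrightarrow> x \<in> X \<Longrightarrow> y \<in> X \<Longrightarrow> k < n \<Longrightarrow> r \<in> {s, -s} \<Longrightarrow>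
      a \<noteq> b \<Longrightarrow> (x, y) \<noteq> (a, b) \<Longrightarrow>
      dot n (tilted_diff a b k r) (\<lambda>i. x i - y i) < dot n (tilted_diff a b k r) (\<lambda>i. a i - b i)"
proof -
  define T where "T = {(a, b, x, y, k, e) \<in> X \<times> X \<times> X \<times> X \<times> {..<n} \<times> {1, -1::real}.
    a \<noteq> b \<and> (x, y) \<noteq> (a, b)}"
  have "finite T"
    unfolding T_def
    by (rule finite_subset[of _ "X \<times> X \<times> X \<times> X \<times> {..<n} \<times> {1, -1}"]) (use X in auto)
  then have "\<exists>s>0. \<forall>t\<in>T. 0 <
      (case t of (a, b, x, y, k, e) \<Rightarrow> dot n (\<lambda>i. a i - b i) (\<lambda>i. a i - b i)
        - dot n (\<lambda>i. a i - b i) (\<lambda>i. x i - y i))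
      + s * (case t of (a, b, x, y, k, e) \<Rightarrow> e * (a k - b k - (x k - y k)))"
    by (rule ex_pos_perturbation)
      (use acute_set_strictly_antipodal[OF X(1)] in \<open>auto simp: T_def\<close>)
  then obtain s where s: "0 < s"
    and sT: "\<And>a b x y k e. (a, b, x, y, k, e) \<in> T \<Longrightarrow>
      0 < dot n (\<lambda>i. a i - b i) (\<lambda>i. a i - b i) - dot n (\<lambda>i. a i - b i) (\<lambda>i. x i - y i)
        + s * (e * (a k - b k - (x k - y k)))"
    by fastforce
  have "dot n (tilted_diff a b k r) (\<lambda>i. x i - y i) < dot n (tilted_diff a b k r) (\<lambda>i. a i - b i)"
    if "a \<in> X" "b \<in> X" "x \<in> X" "y \<in> X" "k < n" "r \<in> {s, -s}" "a \<noteq> b" "(x, y) \<noteq> (a, b)"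
    for a b x y k r
    using sT[of a b x y k 1] sT[of a b x y k "-1"] that
    by (auto simp: T_def dot_tilted_diff algebra_simps)
  with s show ?thesis by (rule that)
qed

text \<open>Here \<open>K\<close> is given by the functionals \<open>a - b\<close>, tilted by \<open>s\<close> and by \<open>- s\<close> along each axis, each bounded
  by half the width of \<open>X\<close>, which \<open>(a - b) / 2\<close> attains. The last property expresses that this
  point is extreme: if \<open>(p + q) / 2\<close> attains the bound of a functional, so do \<open>p\<close> and \<open>q\<close>, and the tilted
  functionals of a single pair separate points, since two opposite tilts along an axis differ by a
  nonzero multiple of the coordinate.\<close>
lemma acute_set_body:
  assumes X: "acute_set n X" "finite X" and card: "2 \<le> card X"
  obtains K where "convex_body n K"
    and "\<And>p. p \<in> K \<Longrightarrow> (\<lambda>i. - p i) \<in> K"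
    and "\<And>x y. x \<in> X \<Longrightarrow> y \<in> X \<Longrightarrow> (\<lambda>i. (x i - y i) / 2) \<in> K"
    and "\<And>a b p q k. a \<in> X \<Longrightarrow> b \<in> X \<Longrightarrow> a \<noteq> b \<Longrightarrow> p \<in> K \<Longrightarrow> q \<in> K \<Longrightarrow>
           (\<And>i. p i + q i = a i - b i) \<Longrightarrow> p k = q k"
proof (rule acute_set_robustly_antipodal[OF X])
  fix s :: real
  assume s: "0 < s" and anti: "\<And>a b x y k r. a \<in> X \<Longrightarrow> b \<in> X \<Longrightarrow> x \<in> X \<Longrightarrow> y \<in> X \<Longrightarrow>
      k < n \<Longrightarrow> r \<in> {s, -s} \<Longrightarrow> a \<noteq> b \<Longrightarrow> (x, y) \<noteq> (a, b) \<Longrightarrow>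
      dot n (tilted_diff a b k r) (\<lambda>i. x i - y i) < dot n (tilted_diff a b k r) (\<lambda>i. a i - b i)"
  define I where "I = {(a, b, k, r) \<in> X \<times> X \<times> {..<n} \<times> {s, -s}. a \<noteq> b}"
  define w where "w = (\<lambda>(a, b, k, r). tilted_diff a b k r)"
  define h where "h = (\<lambda>(a, b, k, r). dot n (tilted_diff a b k r) (\<lambda>i. a i - b i) / 2)"
  define K where "K = {p \<in> topspace (Euclidean_space n). \<forall>i\<in>I. dot n (w i) p \<le> h i}"
  have KE: "p i = 0" if "p \<in> K" "n \<le> i" for p i
    using that by (simp add: K_def topspace_Euclidean_space)
  have XE: "x i = 0" if "x \<in> X" "n \<le> i" for x i
    using that X by (auto simp: acute_set_def topspace_Euclidean_space)
  have dK: "2 * (dot n (\<lambda>i. a i - b i) p + r * p k)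
      \<le> dot n (\<lambda>i. a i - b i) (\<lambda>i. a i - b i) + r * (a k - b k)"
    if "p \<in> K" "a \<in> X" "b \<in> X" "a \<noteq> b" "k < n" "r \<in> {s, -s}" for p a b k r
  proof -
    have "(a, b, k, r) \<in> I" using that by (simp add: I_def)
    then have "dot n (w (a, b, k, r)) p \<le> h (a, b, k, r)"
      using that by (auto simp: K_def)
    then show ?thesis
      using that by (simp add: w_def h_def dot_tilted_diff)
  qed
  have dot_half: "dot n z (\<lambda>i. y i / 2) = dot n z y / 2" for z y
    by (simp add: dot_def sum_divide_distrib)
  have diff_in: "(\<lambda>i. (x i - y i) / 2) \<in> K" if "x \<in> X" "y \<in> X" for x y
  proof -
    have "dot n (tilted_diff a b k r) (\<lambda>i. x i - y i) \<le> dot n (tilted_diff a b k r) (\<lambda>i. a i - b i)"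
      if "a \<in> X" "b \<in> X" "a \<noteq> b" "k < n" "r \<in> {s, -s}" for a b k r
      using anti[of a b x y k r] \<open>x \<in> X\<close> \<open>y \<in> X\<close> that
      by (cases "(x, y) = (a, b)") auto
    then show ?thesis
      using XE[OF that(1)] XE[OF that(2)]
      by (auto simp: K_def topspace_Euclidean_space I_def w_def h_def
          dot_half[of _ "\<lambda>i. x i - y i"])
  qed
  have sym: "(\<lambda>i. - p i) \<in> K" if p: "p \<in> K" for p
  proof -
    have "dot n (tilted_diff a b k r) (\<lambda>i. - p i) \<le> dot n (tilted_diff a b k r) (\<lambda>i. a i - b i) / 2"
      if "a \<in> X" "b \<in> X" "a \<noteq> b" "k < n" "r \<in> {s, -s}" for a b k r
    proof -
      have "2 * (dot n (\<lambda>i. b i - a i) p + (-r) * p k)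
          \<le> dot n (\<lambda>i. b i - a i) (\<lambda>i. b i - a i) + (-r) * (b k - a k)"
        using that by (intro dK[OF p]) auto
      moreover have "dot n z (\<lambda>i. - p i) = - dot n z p" for z
        by (simp add: dot_def sum_negf)
      ultimately show ?thesis
        using that by (simp add: dot_tilted_diff dot_diff_left dot_diff_right algebra_simps)
    qed
    then show ?thesis
      using p by (auto simp: K_def topspace_Euclidean_space I_def w_def h_def)
  qed
  \<comment> \<open>Adding the inequalities for \<open>a0 - b0\<close> and \<open>b0 - a0\<close>, both tilted by \<open>s\<close> along axis \<open>k\<close>, leaves a
    bound on coordinate \<open>k\<close>: a single pair of points of \<open>X\<close> already makes \<open>K\<close> bounded.\<close>
  obtain a0 b0 where ab0: "a0 \<in> X" "b0 \<in> X" "a0 \<noteq> b0"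
    using card by (auto simp: card_le_Suc_iff numeral_2_eq_2)
  define R where "R = dot n (\<lambda>i. a0 i - b0 i) (\<lambda>i. a0 i - b0 i) / (2 * s)"
  have le_R: "p k \<le> R" if "p \<in> K" "k < n" for p k
  proof -
    have "2 * (s * p k) \<le> dot n (\<lambda>i. a0 i - b0 i) (\<lambda>i. a0 i - b0 i)"
      using dK[OF that(1) ab0(1,2) _ that(2), of s] dK[OF that(1) ab0(2,1) _ that(2), of s] ab0(3)
      by (simp add: dot_diff_left dot_diff_right algebra_simps)
    then show ?thesis using s by (simp add: R_def field_simps)
  qed
  have "\<bar>p k\<bar> \<le> R" if "p \<in> K" "k < n" for p k
    using le_R[OF that] le_R[OF sym[OF that(1)] that(2)] by (simp add: abs_le_iff)
  moreover have "0 < h i" if "i \<in> I" for i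
  proof -
    obtain a b k r where i: "i = (a, b, k, r)" by (metis surj_pair)
    \<comment> \<open>the pair \<open>(a, a)\<close> has width 0 and does not attain the maximum\<close>
    have "dot n (tilted_diff a b k r) (\<lambda>i. a i - a i) < dot n (tilted_diff a b k r) (\<lambda>i. a i - b i)"
      using that by (intro anti) (auto simp: I_def i)
    then show ?thesis by (simp add: h_def i dot_def)
  qed
  moreover have "finite I"
    unfolding I_def by (rule finite_subset[of _ "X \<times> X \<times> {..<n} \<times> {s, -s}"]) (use X in auto)
  ultimately have body: "convex_body n K"
    by (intro convex_body_polytope[OF _ _ K_def]) auto
  have mid: "p k = q k"
    if ab: "a \<in> X" "b \<in> X" "a \<noteq> b" and pq: "p \<in> K" "q \<in> K" and eq: "\<And>i. p i + q i = a i - b i"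
    for a b p q k
  proof (cases "k < n")
    case True
    define L where "L r z = dot n (\<lambda>i. a i - b i) z + r * z k" for r z
    have le: "2 * L r p \<le> L r (\<lambda>i. a i - b i)" "2 * L r q \<le> L r (\<lambda>i. a i - b i)"
      if "r \<in> {s, -s}" for r
      using dK[OF pq(1) ab True that] dK[OF pq(2) ab True that] by (simp_all add: L_def)
    have "L r p + L r q = L r (\<lambda>i. p i + q i)" for r
      by (simp add: L_def dot_def distrib_left sum.distrib)
    then have "L r p + L r q = L r (\<lambda>i. a i - b i)" for r
      by (simp add: eq)
    with le have "L r p = L r q" if "r \<in> {s, -s}" for r
      using that by (smt (verit))
    then have "L s p = L s q" "L (-s) p = L (-s) q" by simp_all
    then have "s * p k = s * q k"
      unfolding L_def mult_minus_left by linarith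
    then show ?thesis using s by simp
  next
    case False
    then show ?thesis using KE[OF pq(1), of k] KE[OF pq(2), of k] by simp
  qed
  show ?thesis
    using body sym diff_in mid by (rule that)
qed

section \<open>Transversals and independence\<close>

definition translate :: "(nat \<Rightarrow> real) set \<Rightarrow> (nat \<Rightarrow> real) \<Rightarrow> (nat \<Rightarrow> real) set" where
  "translate K x = (\<lambda>y i. y i + x i) ` K"

lemma mem_translate_iff: "t \<in> translate K x \<longleftrightarrow> (\<lambda>i. t i - x i) \<in> K"
  unfolding translate_def image_iff
  by (auto intro: bexI[of _ "\<lambda>i. t i - x i"])

lemma independence_number_le_1:
  assumes "\<And>A B. A \<in> \<F> \<Longrightarrow> B \<in> \<F> \<Longrightarrow> A \<inter> B \<noteq> {}"
  shows "independence_number \<F> \<le> 1"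
  unfolding independence_number_def
proof (rule Sup_least, clarify)
  fix S assume S: "S \<subseteq> \<F>" "disjoint S"
  have "A = B" if "A \<in> S" "B \<in> S" for A B
    using S assms[of A B] that by (auto simp: disjoint_def)
  then have "S = {} \<or> (\<exists>A. S = {A})" by blast
  then show "ecard S \<le> 1" by (auto simp: ecard_def one_enat_def)
qed

text \<open>Double counting: each point of a transversal accounts for at most \<open>m\<close> of the \<open>card X\<close> members.\<close>
lemma transversal_number_ge:
  assumes fin: "finite X"
    and few: "\<And>t. card {x \<in> X. t \<in> F x} \<le> m"
    and le: "\<And>k. card X \<le> k * m \<Longrightarrow> l \<le> k"
  shows "enat l \<le> transversal_number n (F ` X)"
  unfolding transversal_number_def
proof (rule Inf_greatest, clarify)
  fix S assume S: "\<forall>A\<in>F ` X. S \<inter> A \<noteq> {}"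
  show "enat l \<le> ecard S"
  proof (cases "finite S")
    case True
    have "X = (\<Union>t\<in>S. {x \<in> X. t \<in> F x})" using S by blast
    then have "card X \<le> (\<Sum>t\<in>S. card {x \<in> X. t \<in> F x})"
      using card_UN_le[OF True, of "\<lambda>t. {x \<in> X. t \<in> F x}"] by simp
    also have "\<dots> \<le> card S * m"
      using sum_bounded_above[of S "\<lambda>t. card {x \<in> X. t \<in> F x}" m] few by simp
    finally show ?thesis
      using True le by (simp add: ecard_def)
  qed (simp add: ecard_def)
qed

lemma acute_set_family:
  assumes X: "acute_set n X" "finite X" "card X = 2 * l" and l: "0 < l"
  shows "\<exists>K \<F>. convex_body n K \<and> \<F> \<subseteq> translates n K \<and> \<F> \<noteq> {} \<and>
    independence_number \<F> \<le> 1 \<and> enat l \<le> transversal_number n \<F>"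
proof -
  have card2: "2 \<le> card X" using X l by simp
  obtain K where K: "convex_body n K"
    and sym: "\<And>p. p \<in> K \<Longrightarrow> (\<lambda>i. - p i) \<in> K"
    and diff: "\<And>x y. x \<in> X \<Longrightarrow> y \<in> X \<Longrightarrow> (\<lambda>i. (x i - y i) / 2) \<in> K"
    and mid: "\<And>a b p q k. a \<in> X \<Longrightarrow> b \<in> X \<Longrightarrow> a \<noteq> b \<Longrightarrow> p \<in> K \<Longrightarrow> q \<in> K \<Longrightarrow>
           (\<And>i. p i + q i = a i - b i) \<Longrightarrow> p k = q k"
    by (rule acute_set_body[OF X(1,2) card2]) blast
  have midpoint: "t k = (a k + b k) / 2"
    if "a \<in> X" "b \<in> X" "a \<noteq> b" "t \<in> translate K a" "t \<in> translate K b" for a b t k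
    using mid[of a b "\<lambda>i. a i - t i" "\<lambda>i. t i - b i" k] that sym[of "\<lambda>i. t i - a i"]
    by (simp add: mem_translate_iff)
  have few: "card {x \<in> X. t \<in> translate K x} \<le> 2" for t
  proof (rule ccontr)
    assume "\<not> ?thesis"
    then have "3 \<le> card {x \<in> X. t \<in> translate K x}" by simp
    then obtain a b c where abc: "a \<in> {x \<in> X. t \<in> translate K x}"
      "b \<in> {x \<in> X. t \<in> translate K x}" "c \<in> {x \<in> X. t \<in> translate K x}"
      "a \<noteq> b" "a \<noteq> c" "b \<noteq> c"
      by (auto simp: card_le_Suc_iff numeral_3_eq_3)
    have "b k = c k" for k
      using midpoint[of a b t k] midpoint[of a c t k] abc by auto
    with abc show False by blast
  qed
  have "translate K x \<inter> translate K y \<noteq> {}" if "x \<in> X" "y \<in> X" for x y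
  proof -
    have *: "(\<lambda>i. (x i + y i) / 2 - x i) = (\<lambda>i. (y i - x i) / 2)"
      "(\<lambda>i. (x i + y i) / 2 - y i) = (\<lambda>i. (x i - y i) / 2)"
      by (auto simp: field_simps)
    have "(\<lambda>i. (x i + y i) / 2) \<in> translate K x" "(\<lambda>i. (x i + y i) / 2) \<in> translate K y"
      unfolding mem_translate_iff * using diff that by auto
    then show ?thesis by blast
  qed
  then have "independence_number (translate K ` X) \<le> 1"
    by (intro independence_number_le_1) auto
  moreover have "enat l \<le> transversal_number n (translate K ` X)"
    using X(3) by (intro transversal_number_ge[OF X(2) few]) auto
  moreover have "translate K ` X \<subseteq> translates n K"
    using X(1) by (auto simp: translates_def translate_def acute_set_def)
  moreover have "translate K ` X \<noteq> {}" using card2 by auto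
  ultimately show ?thesis using K by blast
qed

text \<open>The exponent \<open>n div 2\<close> loses a factor \<open>c\<close> for odd \<open>n\<close>. The base \<open>5 / 4\<close> is small enough to
  absorb it at \<open>n = 3\<close>, and its square is less than 2.\<close>
lemma power_le_two_power_half:
  fixes c :: real
  assumes c: "0 \<le> c" "c \<le> 5 / 4" and n: "2 \<le> n"
  shows "c ^ n \<le> 2 ^ (n div 2)"
proof -
  define q where "q = n div 2"
  have "(5 / 4 :: real) ^ (2 * Suc k + 1) \<le> 2 ^ Suc k" for k
  proof (induction k)
    case (Suc k)
    have "(5 / 4 :: real) ^ (2 * Suc (Suc k) + 1) = 25 / 16 * (5 / 4) ^ (2 * Suc k + 1)"
      by (simp add: power2_eq_square)
    also have "\<dots> \<le> 2 * 2 ^ Suc k" using Suc by (intro mult_mono) auto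
    finally show ?case by simp
  qed (simp add: power3_eq_cube eval_nat_numeral)
  then have q: "(5 / 4 :: real) ^ (2 * q + 1) \<le> 2 ^ q"
    using n by (cases q) (auto simp: q_def)
  have "c ^ n \<le> (5 / 4) ^ n" using c by (intro power_mono) auto
  also have "\<dots> \<le> (5 / 4) ^ (2 * q + 1)" by (intro power_increasing) (auto simp: q_def)
  finally show ?thesis using q by (simp add: q_def)
qed

theorem proposition2:
  shows "\<forall>\<^sub>F n in sequentially.
    \<exists>(K :: (nat \<Rightarrow> real) set) (\<F> :: (nat \<Rightarrow> real) set set).
      convex_body n K \<and> \<F> \<subseteq> translates n K \<and>
      \<F> \<noteq> {} \<and> independence_number \<F> \<noteq> \<infinity> \<and>
      ereal_of_enat (transversal_number n \<F>)
        \<ge> ereal (1 / 2 * 1.058 ^ n) * ereal_of_enat (independence_number \<F>)"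
  using eventually_ge_at_top[of 2]
proof eventually_elim
  case (elim n)
  define l :: nat where "l = 2 ^ (n div 2 - 1)"
  have l: "2 ^ (n div 2) = 2 * l" "0 < l"
    using elim by (auto simp: l_def simp flip: power_Suc)
  obtain X where "acute_set n X" "finite X" "card X = 2 * l"
    using ex_acute_set[of n] unfolding l(1) by blast
  then obtain K \<F> where K: "convex_body n K" "\<F> \<subseteq> translates n K" "\<F> \<noteq> {}"
    and \<nu>: "independence_number \<F> \<le> 1" and \<tau>: "enat l \<le> transversal_number n \<F>"
    using acute_set_family[OF _ _ _ l(2)] by metis
  have "(1.058 :: real) ^ n \<le> real (2 ^ (n div 2))"
    using power_le_two_power_half[of "1.058" n] elim by simp
  then have bound: "1 / 2 * (1.058 :: real) ^ n \<le> real l"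
    unfolding l(1) by simp
  have "ereal (1 / 2 * 1.058 ^ n) * ereal_of_enat (independence_number \<F>)
      \<le> ereal (1 / 2 * 1.058 ^ n) * ereal_of_enat 1"
    using \<nu> by (intro ereal_mult_left_mono) (simp_all del: ereal_of_enat_simps)
  also have "\<dots> = ereal (1 / 2 * 1.058 ^ n)" by (simp add: one_enat_def)
  also have "\<dots> \<le> ereal_of_enat (enat l)" using bound by simp
  also have "\<dots> \<le> ereal_of_enat (transversal_number n \<F>)"
    using \<tau> by (simp only: ereal_of_enat_le_iff)
  finally have "ereal_of_enat (transversal_number n \<F>)
      \<ge> ereal (1 / 2 * 1.058 ^ n) * ereal_of_enat (independence_number \<F>)" .
  moreover have "independence_number \<F> \<noteq> \<infinity>"
    using \<nu> by (intro notI) simp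
  ultimately show ?case using K by blast
qed

end
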